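(* Let $G=(V,E)$ be a transitive acyclic digraph. Then for every topological ordering $v_1<\dots<v_n$ of $G$, the greedy coloring along this ordering is an oriented coloring of $G$ using exactly $\chi_o(G)$ colors (i.e., it is an optimal oriented coloring). Moreover, $\chi_o(G)$ can be computed in linear time, i.e. in time $O(|V|+|E|)$.
   Context: A digraph $G=(V,E)$ has a finite vertex set $V$ and arc set $E\subseteq\{(u,v)\mid u,v\in V, u\neq v\}$. It is acyclic if it contains no directed cycle (of any length $\ge 2$); in particular it has no pair of opposite arcs, so it is an oriented graph. It is transitive if for all arcs $(u,v),(v,w)\in E$ with $u\neq w$ also $(u,w)\in E$. A topological ordering is a linear ordering of $V$ such that for every arc $(u,v)$, $u$ comes before $v$. The underlying undirected graph is $\mathrm{un}(G)=(V,\{\{u,v\}\mid (u,v)\in E\})$. The greedy coloring along an ordering $v_1<\dots<v_n$ assigns $c(v_1)=1$ and, for $i=2,\dots,n$, $c(v_i)$ = the smallest positive integer not equal to $c(v)$ for any neighbor $v$ of $v_i$ in $\mathrm{un}(G)$ that has already been colored. An oriented $r$-coloring of an oriented graph $G=(V,E)$ is a map $c:V\to\{1,\dots,r\}$ such that $c(u)\neq c(v)$ for every $(u,v)\in E$, and $c(u)\neq c(y)$ for every two arcs $(u,v),(x,y)\in E$ with $c(v)=c(x)$. The oriented chromatic number $\chi_o(G)$ is the smallest $r$ such that $G$ has an oriented $r$-coloring. *)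

theory Defs
  imports "Graph_Theory.Graph_Theory"
begin

section \<open>Digraphs\<close>

text \<open>
  The locale \<^locale>\<open>pair_digraph\<close> describes finite digraphs without loops and parallel arcs.
  The library notion of a cycle admits loops, but since those are excluded, every cycle of a
  \<^locale>\<open>pair_digraph\<close> has length at least 2 (fact \<open>cycle_digraph_conv\<close>).
\<close>

definition acyclic_digraph :: "'a pair_pre_digraph \<Rightarrow> bool" where
  "acyclic_digraph G \<longleftrightarrow> \<not> (\<exists>p. pre_digraph.cycle (with_proj G) p)"

definition transitive_digraph :: "'a pair_pre_digraph \<Rightarrow> bool" where
  "transitive_digraph G \<longleftrightarrow>
     (\<forall>u v w. (u, v) \<in> parcs G \<and> (v, w) \<in> parcs G \<and> u \<noteq> w \<longrightarrow> (u, w) \<in> parcs G)"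

definition transitive_acyclic_digraph :: "'a pair_pre_digraph \<Rightarrow> bool" where
  "transitive_acyclic_digraph G \<longleftrightarrow>
     pair_digraph G \<and> transitive_digraph G \<and> acyclic_digraph G"

definition topological_ordering :: "'a pair_pre_digraph \<Rightarrow> 'a list \<Rightarrow> bool" where
  "topological_ordering G vs \<longleftrightarrow>
     distinct vs \<and> set vs = pverts G \<and>
     (\<forall>i < length vs. \<forall>j < length vs. (vs ! i, vs ! j) \<in> parcs G \<longrightarrow> i < j)"

definition un_edges :: "'a pair_pre_digraph \<Rightarrow> 'a set set" where
  "un_edges G = {{u, v} | u v. (u, v) \<in> parcs G}"

section \<open>Greedy coloring\<close>

text \<open>The domain of the map \<open>c\<close> is the set of vertices colored so far.\<close>

fun greedy_from :: "'a pair_pre_digraph \<Rightarrow> ('a \<rightharpoonup> nat) \<Rightarrow> 'a list \<Rightarrow> ('a \<rightharpoonup> nat)" where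
  "greedy_from G c [] = c"
| "greedy_from G c (v # vs) =
     greedy_from G
       (c(v \<mapsto> (LEAST k. 1 \<le> k \<and> (\<forall>u. {u, v} \<in> un_edges G \<longrightarrow> c u \<noteq> Some k)))) vs"

definition greedy_coloring :: "'a pair_pre_digraph \<Rightarrow> 'a list \<Rightarrow> 'a \<Rightarrow> nat" where
  "greedy_coloring G vs v = the (greedy_from G Map.empty vs v)"

section \<open>Oriented coloring\<close>

definition oriented_coloring :: "'a pair_pre_digraph \<Rightarrow> nat \<Rightarrow> ('a \<Rightarrow> nat) \<Rightarrow> bool" where
  "oriented_coloring G r c \<longleftrightarrow>
     c ` pverts G \<subseteq> {1..r} \<and>
     (\<forall>(u, v) \<in> parcs G. c u \<noteq> c v) \<and>
     (\<forall>(u, v) \<in> parcs G. \<forall>(x, y) \<in> parcs G. c v = c x \<longrightarrow> c u \<noteq> c y)"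

definition oriented_chromatic_number :: "'a pair_pre_digraph \<Rightarrow> nat" where
  "oriented_chromatic_number G = (LEAST r. \<exists>c. oriented_coloring G r c)"

section \<open>Random access machine\<close>

text \<open>
  A word RAM with structured control flow. A state \<open>(R, M)\<close> consists of the registers \<open>R\<close>, whose
  indices are fixed in the program text, and the memory \<open>M\<close>, which is addressed indirectly through
  registers. \<open>Load i j\<close> reads \<open>M (R j)\<close> into register \<open>i\<close>, and \<open>Store i j\<close> writes register \<open>j\<close> to
  the memory cell with address \<open>R i\<close>. \<open>Sub\<close> is truncated subtraction. \<open>Cond\<close> and \<open>Loop\<close> test
  whether a register is nonzero.
\<close>

datatype ram_prog =
    Skip
  | SetConst nat nat
  | Add nat nat nat
  | Sub nat nat nat
  | Load nat nat
  | Store nat nat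
  | Seq ram_prog ram_prog
  | Cond nat ram_prog ram_prog
  | Loop nat ram_prog

type_synonym ram_state = "(nat \<Rightarrow> nat) \<times> (nat \<Rightarrow> nat)"

text \<open>
  \<open>ram_exec W p s t s'\<close>: started in state \<open>s\<close>, program \<open>p\<close> terminates in state \<open>s'\<close> after exactly
  \<open>t\<close> elementary steps (instructions and tests), without ever producing a number larger than the
  word bound \<open>W\<close>; a program that would do so gets stuck. For \<open>W\<close> linear in the input size, words
  have logarithmic length, which justifies charging one unit per step.
\<close>

inductive ram_exec :: "nat \<Rightarrow> ram_prog \<Rightarrow> ram_state \<Rightarrow> nat \<Rightarrow> ram_state \<Rightarrow> bool" for W :: nat where
  Skip: "ram_exec W Skip s 1 s"
| SetConst: "k \<le> W \<Longrightarrow> ram_exec W (SetConst i k) (R, M) 1 (R(i := k), M)"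
| Add: "R j + R k \<le> W \<Longrightarrow> ram_exec W (Add i j k) (R, M) 1 (R(i := R j + R k), M)"
| Sub: "ram_exec W (Sub i j k) (R, M) 1 (R(i := R j - R k), M)"
| Load: "ram_exec W (Load i j) (R, M) 1 (R(i := M (R j)), M)"
| Store: "ram_exec W (Store i j) (R, M) 1 (R, M(R i := R j))"
| Seq: "ram_exec W p s t s' \<Longrightarrow> ram_exec W q s' t' s'' \<Longrightarrow> ram_exec W (Seq p q) s (t + t') s''"
| CondTrue: "fst s i \<noteq> 0 \<Longrightarrow> ram_exec W p s t s' \<Longrightarrow> ram_exec W (Cond i p q) s (1 + t) s'"
| CondFalse: "fst s i = 0 \<Longrightarrow> ram_exec W q s t s' \<Longrightarrow> ram_exec W (Cond i p q) s (1 + t) s'"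
| LoopFalse: "fst s i = 0 \<Longrightarrow> ram_exec W (Loop i p) s 1 s"
| LoopTrue: "fst s i \<noteq> 0 \<Longrightarrow> ram_exec W p s t s' \<Longrightarrow> ram_exec W (Loop i p) s' t' s'' \<Longrightarrow>
     ram_exec W (Loop i p) s (1 + t + t') s''"

inductive_cases ram_exec_elims:
  "ram_exec W Skip s t s'" "ram_exec W (SetConst i k) s t s'" "ram_exec W (Add i j k) s t s'"
  "ram_exec W (Sub i j k) s t s'" "ram_exec W (Load i j) s t s'" "ram_exec W (Store i j) s t s'"
  "ram_exec W (Seq p q) s t s'" "ram_exec W (Cond i p q) s t s'"

inductive_cases ram_exec_LoopE: "ram_exec W (Loop i p) s t s'"

lemma ram_exec_deterministic:
  "ram_exec W p s t s' \<Longrightarrow> ram_exec W p s u u' \<Longrightarrow> u = t \<and> u' = s'"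
proof (induction arbitrary: u u' rule: ram_exec.induct)
  case (Seq p s t s' q t' s'')
  from Seq.prems show ?case
  proof (rule ram_exec_elims(7))
    fix t1 s1 t2
    assume *: "u = t1 + t2" "ram_exec W p s t1 s1" "ram_exec W q s1 t2 u'"
    have 1: "t1 = t \<and> s1 = s'" by (rule Seq.IH(1)[OF *(2)])
    have "t2 = t' \<and> u' = s''" by (rule Seq.IH(2)) (use *(3) 1 in simp)
    with *(1) 1 show "u = t + t' \<and> u' = s''" by simp
  qed
next
  case (CondTrue s i p t s' q)
  from CondTrue.prems show ?case
    by (rule ram_exec_elims(8)) (use CondTrue.hyps(1) in \<open>auto dest!: CondTrue.IH\<close>)
next
  case (CondFalse s i q t s' p)
  from CondFalse.prems show ?case
    by (rule ram_exec_elims(8)) (use CondFalse.hyps(1) in \<open>auto dest!: CondFalse.IH\<close>)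
next
  case (LoopFalse s i p)
  from LoopFalse.prems show ?case by (rule ram_exec_LoopE) (use LoopFalse.hyps(1) in auto)
next
  case (LoopTrue s i p t s' t' s'')
  from LoopTrue.prems show ?case
  proof (rule ram_exec_LoopE)
    fix t1 s1 t2
    assume *: "u = Suc (t1 + t2)" "ram_exec W p s t1 s1" "ram_exec W (Loop i p) s1 t2 u'"
    have 1: "t1 = t \<and> s1 = s'" by (rule LoopTrue.IH(1)[OF *(2)])
    have "t2 = t' \<and> u' = s''" by (rule LoopTrue.IH(2)) (use *(3) 1 in simp)
    with *(1) 1 show "u = 1 + t + t' \<and> u' = s''" by simp
  qed (use LoopTrue.hyps(1) in simp)
qed (auto elim!: ram_exec_elims(1-6))

section \<open>Linear-time computation on digraphs\<close>

text \<open>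
  \<open>xs\<close> numbers the vertices, and \<open>adj ! i\<close> lists, in arbitrary order and without repetition, the
  numbers of the out-neighbors of the \<open>i\<close>-th vertex.
\<close>

definition adjacency_lists ::
  "'a pair_pre_digraph \<Rightarrow> 'a list \<Rightarrow> nat list list \<Rightarrow> bool" where
  "adjacency_lists G xs adj \<longleftrightarrow>
     distinct xs \<and> set xs = pverts G \<and> length adj = length xs \<and>
     (\<forall>i < length xs. distinct (adj ! i) \<and>
        set (adj ! i) = {j. j < length xs \<and> (xs ! i, xs ! j) \<in> parcs G})"

text \<open>
  The number of vertices, followed by each adjacency list preceded by its length:
  \<open>1 + |V| + |E|\<close> words in total.
\<close>

definition encode_adj :: "nat list list \<Rightarrow> nat list" where
  "encode_adj adj = length adj # concat (map (\<lambda>ns. length ns # ns) adj)"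

definition ram_input :: "nat list \<Rightarrow> ram_state" where
  "ram_input ws = (\<lambda>_. 0, \<lambda>a. if a < length ws then ws ! a else 0)"

text \<open>
  One program computes \<open>f\<close>, returned in register \<open>0\<close>, on all digraphs satisfying \<open>P\<close>, for every
  vertex numbering and every order of the adjacency lists. The summand \<open>1\<close> accounts for the empty
  digraph.
\<close>

definition linear_time_computable ::
  "('a pair_pre_digraph \<Rightarrow> bool) \<Rightarrow> ('a pair_pre_digraph \<Rightarrow> nat) \<Rightarrow> bool" where
  "linear_time_computable P f \<longleftrightarrow>
     (\<exists>p C. \<forall>G xs adj. P G \<and> adjacency_lists G xs adj \<longrightarrow>
        (\<exists>t R M.
           ram_exec (C * (card (pverts G) + card (parcs G) + 1)) p
             (ram_input (encode_adj adj)) t (R, M) \<and>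
           t \<le> C * (card (pverts G) + card (parcs G) + 1) \<and>
           R 0 = f G))"

end

theory Submission
  imports Defs
begin

text \<open>
  The arcs form a strict partial order. A vertex of height \<open>k\<close> (the maximal number of vertices of a
  chain ending there, or dually starting there) tops a chain of \<open>k\<close> vertices, which are pairwise
  adjacent by transitivity; so every oriented coloring needs as many colors as the maximal height,
  and the height function itself is an oriented coloring, being strictly monotone along the arcs.
  Along a topological ordering, the colors of the predecessors of a vertex form an initial segment
  by transitivity, so greedy assigns exactly the heights.

  For linear time, transitivity makes the out-degree strictly decrease along arcs, so a bucket sort
  by out-degree replaces a topological sort; the heights are then computed bucket by bucket.
\<close>

section \<open>Height functions of transitive relations\<close>

text \<open>A local description, so that one notion fits a recursively defined function (with
  \<open>r\<close> the arcs) as well as the greedy coloring (with \<open>r\<close> the converse of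
  the arcs).\<close>

definition height_on :: "'a set \<Rightarrow> ('a \<times> 'a) set \<Rightarrow> ('a \<Rightarrow> nat) \<Rightarrow> bool" where
  "height_on V r c \<longleftrightarrow>
     (\<forall>v\<in>V. 1 \<le> c v \<and> (1 < c v \<longrightarrow> (\<exists>w. (v, w) \<in> r \<and> Suc (c w) = c v))) \<and>
     (\<forall>(v, w)\<in>r. c w < c v)"

lemma height_on_clique:
  assumes "height_on V r c" "trans r" "r \<subseteq> V \<times> V" "v \<in> V"
  shows "\<exists>S. finite S \<and> card S = c v \<and> v \<in> S \<and> S \<subseteq> insert v (r `` {v}) \<and>
             (\<forall>x\<in>S. \<forall>y\<in>S. x \<noteq> y \<longrightarrow> (x, y) \<in> r \<or> (y, x) \<in> r)"
  using assms(4)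
proof (induction "c v" arbitrary: v rule: less_induct)
  case less
  show ?case
  proof (cases "1 < c v")
    case False
    then have "c v = 1" using assms(1) less.prems by (force simp: height_on_def)
    then show ?thesis by (intro exI[of _ "{v}"]) auto
  next
    case True
    then obtain w where w: "(v, w) \<in> r" "Suc (c w) = c v"
      using assms(1) less.prems unfolding height_on_def by blast
    have "w \<in> V" using w(1) assms(3) by auto
    then obtain S where S: "finite S" "card S = c w" "w \<in> S" "S \<subseteq> insert w (r `` {w})"
        "\<forall>x\<in>S. \<forall>y\<in>S. x \<noteq> y \<longrightarrow> (x, y) \<in> r \<or> (y, x) \<in> r"
      using less.hyps[of w] w(2) by auto
    have succ: "S \<subseteq> r `` {v}" using S(4) w(1) assms(2) by (auto dest: transD)
    have "v \<notin> r `` {v}" using assms(1) by (auto simp: height_on_def)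
    then have "v \<notin> S" using succ by blast
    then show ?thesis
      using S succ w(2) by (intro exI[of _ "insert v S"]) auto
  qed
qed

text \<open>There are no gaps, since the witnesses descend in steps of one. Hence the number of
  values equals the largest one.\<close>

lemma height_on_image:
  assumes "height_on V r c" "r \<subseteq> V \<times> V" "finite V"
  shows "c ` V = {1..Max (insert 0 (c ` V))}"
proof -
  have down: "\<exists>w\<in>V. c w = k" if "v \<in> V" "1 \<le> k" "k \<le> c v" for v k
    using that
  proof (induction "c v" arbitrary: v rule: less_induct)
    case less
    show ?case
    proof (cases "k = c v")
      case False
      then have "1 < c v" using less.prems by auto
      then obtain w where "(v, w) \<in> r" "Suc (c w) = c v"
        using assms(1) less.prems(1) unfolding height_on_def by blast
      then show ?thesis using less False assms(2) by (intro less.hyps[of w]) auto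
    qed (use less.prems in auto)
  qed
  show ?thesis
  proof
    show "c ` V \<subseteq> {1..Max (insert 0 (c ` V))}"
      using assms(1,3) by (auto simp: height_on_def)
    show "{1..Max (insert 0 (c ` V))} \<subseteq> c ` V"
    proof
      fix k assume k: "k \<in> {1..Max (insert 0 (c ` V))}"
      have "Max (insert 0 (c ` V)) \<in> insert 0 (c ` V)" using assms(3) by (intro Max_in) auto
      then obtain v where "v \<in> V" "c v = Max (insert 0 (c ` V))" using k by auto
      then show "k \<in> c ` V" using down[of v k] k by auto
    qed
  qed
qed

lemma height_on_eq_Suc_Max:
  assumes "height_on V r c" "v \<in> V" "finite (r `` {v})"
  shows "c v = Suc (Max (insert 0 (c ` (r `` {v}))))"
proof (cases "1 < c v")
  case True
  then obtain w where w: "(v, w) \<in> r" "Suc (c w) = c v"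
    using assms(1,2) unfolding height_on_def by blast
  have "Max (insert 0 (c ` (r `` {v}))) = c w"
    using assms(1,3) w by (intro Max_eqI) (auto simp: height_on_def)
  then show ?thesis using w by simp
next
  case False
  then have c: "c v = 1" using assms(1,2) by (force simp: height_on_def)
  \<comment> \<open>Here \<open>w\<close> may lie outside \<open>V\<close>, where the value 0 is
    possible.\<close>
  have "c w = 0" if "(v, w) \<in> r" for w using assms(1) c that by (force simp: height_on_def)
  then have "c ` (r `` {v}) \<subseteq> {0}" by auto
  then have "insert 0 (c ` (r `` {v})) = {0}" by blast
  then show ?thesis unfolding c by (metis Max_singleton One_nat_def)
qed

text \<open>The equation of \<open>height_on_eq_Suc_Max\<close> serves as a definition by recursion
  along the arcs, well-founded because \<open>r\<close> is finite and acyclic.\<close>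

lemma ex_height_on:
  assumes "finite V" "r \<subseteq> V \<times> V" "trans r" "irrefl r"
  shows "\<exists>c. height_on V r c"
proof -
  define F where "F = (\<lambda>(f :: 'a \<Rightarrow> nat) v. Suc (Max (insert 0 (f ` (r `` {v})))))"
  define c where "c = wfrec (r\<inverse>) F"
  have fin: "finite r" using assms(1,2) finite_subset by blast
  have wf: "wf (r\<inverse>)"
    using fin assms(3,4) by (intro finite_acyclic_wf_converse) (auto simp: acyclic_irrefl)
  have eq: "c v = Suc (Max (insert 0 (c ` (r `` {v}))))" for v
  proof -
    have "c v = F (cut c (r\<inverse>) v) v" by (simp add: c_def wfrec[OF wf])
    also have "cut c (r\<inverse>) v ` (r `` {v}) = c ` (r `` {v})"
      by (intro image_cong) (auto simp: cut_apply)
    then have "F (cut c (r\<inverse>) v) v = Suc (Max (insert 0 (c ` (r `` {v}))))"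
      by (simp add: F_def)
    finally show ?thesis .
  qed
  have finI: "finite (r `` {v})" for v using fin by (rule finite_Image)
  have "c w < c v" if "(v, w) \<in> r" for v w
    unfolding eq[of v] using that finI[of v] by (simp add: less_Suc_eq_le Max_ge)
  moreover have "\<exists>w. (v, w) \<in> r \<and> Suc (c w) = c v" if "1 < c v" for v
  proof -
    have "Max (insert 0 (c ` (r `` {v}))) \<in> insert 0 (c ` (r `` {v}))"
      using finI by (intro Max_in) auto
    then show ?thesis using that eq[of v] by auto
  qed
  ultimately have "height_on V r c"
    unfolding height_on_def using eq by (metis (no_types, lifting) case_prodI2 le_add1 plus_1_eq_Suc)
  then show ?thesis by blast
qed

section \<open>Oriented colorings of transitive acyclic digraphs\<close>

text \<open>\<open>transitive_digraph\<close> exempts the case \<open>u = w\<close>. Two opposite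
  arcs would form a cycle, so that case never occurs and plain \<open>trans\<close> follows.\<close>

lemma transitive_acyclic_digraphD:
  assumes "transitive_acyclic_digraph G"
  shows "finite (pverts G)" "parcs G \<subseteq> pverts G \<times> pverts G" "irrefl (parcs G)" "trans (parcs G)"
proof -
  interpret pair_digraph G using assms by (simp add: transitive_acyclic_digraph_def)
  show "finite (pverts G)" using finite_verts by simp
  show sub: "parcs G \<subseteq> pverts G \<times> pverts G"
    using in_arcsD1 in_arcsD2 by auto
  show irr: "irrefl (parcs G)" using no_loops by (force simp: irrefl_def)
  have antisym: "(v, u) \<notin> parcs G" if "(u, v) \<in> parcs G" for u v
  proof
    assume "(v, u) \<in> parcs G"
    then have "cycle [(u, v), (v, u)]"
      using that sub irr unfolding cycle_def
      by (intro exI[of _ u]) (auto simp: awalk_def irrefl_def)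
    then show False
      using assms by (auto simp: transitive_acyclic_digraph_def acyclic_digraph_def)
  qed
  show "trans (parcs G)"
    using assms antisym
    unfolding trans_def transitive_acyclic_digraph_def transitive_digraph_def by blast
qed

text \<open>Colors change strictly in one direction along all arcs, so no two arcs join the same two
  colors in opposite directions. Conversely, a vertex of maximal height lies in a clique of that
  size, on which every oriented coloring is injective.\<close>

lemma height_on_optimal_oriented_coloring:
  assumes G: "transitive_acyclic_digraph G"
    and r: "r = parcs G \<or> r = (parcs G)\<inverse>"
    and c: "height_on (pverts G) r c"
  shows "oriented_coloring G (oriented_chromatic_number G) c"
    and "card (c ` pverts G) = oriented_chromatic_number G"
    and "oriented_chromatic_number G = Max (insert 0 (c ` pverts G))"
proof -
  note D = transitive_acyclic_digraphD[OF G]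
  define h where "h = Max (insert 0 (c ` pverts G))"
  have r': "trans r" "r \<subseteq> pverts G \<times> pverts G" using r D by auto
  have img: "c ` pverts G = {1..h}"
    using height_on_image[OF c r'(2) D(1)] by (simp add: h_def)
  have mono: "(\<forall>(u, v)\<in>parcs G. c u < c v) \<or> (\<forall>(u, v)\<in>parcs G. c v < c u)"
    using r c by (auto simp: height_on_def)
  have col: "oriented_coloring G h c"
    unfolding oriented_coloring_def img
  proof (intro conjI ballI; clarify?)
    fix u v assume "(u, v) \<in> parcs G" "c u = c v"
    then show False using mono by auto
  next
    fix u v x y assume "(u, v) \<in> parcs G" "(x, y) \<in> parcs G" "c v = c x" "c u = c y"
    then show False using mono by (metis (mono_tags, lifting) case_prodD less_asym)
  qed
  have "h \<le> k" if c': "oriented_coloring G k c'" for k c'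
  proof (cases "h = 0")
    case False
    then have "h \<in> c ` pverts G" using img by auto
    then obtain v where v: "v \<in> pverts G" "c v = h" by auto
    obtain S where S: "finite S" "card S = h" "v \<in> S" "S \<subseteq> insert v (r `` {v})"
        "\<forall>x\<in>S. \<forall>y\<in>S. x \<noteq> y \<longrightarrow> (x, y) \<in> r \<or> (y, x) \<in> r"
      using height_on_clique[OF c r' v(1)] v(2) by auto
    have "S \<subseteq> pverts G" using S(4) r'(2) v(1) by auto
    then have "c' ` S \<subseteq> {1..k}" using c' by (auto simp: oriented_coloring_def)
    moreover have "inj_on c' S"
    proof (rule inj_onI, rule ccontr)
      fix x y assume xy: "x \<in> S" "y \<in> S" "c' x = c' y" "x \<noteq> y"
      then have "(x, y) \<in> parcs G \<or> (y, x) \<in> parcs G" using S(5) r by auto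
      then show False using xy(3) c' by (auto simp: oriented_coloring_def)
    qed
    ultimately have "card S \<le> card {1..k}" by (intro card_inj_on_le) auto
    then show ?thesis using S by simp
  qed simp
  then have h: "oriented_chromatic_number G = h"
    unfolding oriented_chromatic_number_def using col by (intro Least_equality) auto
  show "oriented_coloring G (oriented_chromatic_number G) c" using h col by simp
  show "card (c ` pverts G) = oriented_chromatic_number G" using h img by simp
  show "oriented_chromatic_number G = Max (insert 0 (c ` pverts G))" using h h_def by simp
qed

section \<open>The greedy coloring\<close>

text \<open>Exposes the last coloring step, as needed for induction over the colored prefix.\<close>

lemma greedy_from_snoc:
  "greedy_from G c (xs @ [v]) =
     (greedy_from G c xs)(v \<mapsto> (LEAST k. 1 \<le> k \<and>
        (\<forall>u. {u, v} \<in> un_edges G \<longrightarrow> greedy_from G c xs u \<noteq> Some k)))"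
  by (induction xs arbitrary: c) auto

lemma un_edges_iff: "{u, v} \<in> un_edges G \<longleftrightarrow> (u, v) \<in> parcs G \<or> (v, u) \<in> parcs G"
  by (auto simp: un_edges_def doubleton_eq_iff)

text \<open>A finite downward closed set of positive numbers ends right before the least positive
  number it misses.\<close>

lemma Least_not_in_eq:
  fixes C :: "nat set"
  assumes "finite C" "0 \<notin> C" "\<And>k l. k \<in> C \<Longrightarrow> 1 \<le> l \<Longrightarrow> l < k \<Longrightarrow> l \<in> C"
  shows "1 \<le> (LEAST k. 1 \<le> k \<and> k \<notin> C)" "C = {1..<LEAST k. 1 \<le> k \<and> k \<notin> C}"
proof -
  define m where "m = (LEAST k. 1 \<le> k \<and> k \<notin> C)"
  have "\<exists>k. 1 \<le> k \<and> k \<notin> C"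
    using assms(1) by (metis Max_ge Suc_n_not_le_n le_add1 plus_1_eq_Suc)
  then have m: "1 \<le> m \<and> m \<notin> C" unfolding m_def by (rule LeastI_ex)
  have below: "l \<in> C" if "1 \<le> l" "l < m" for l using not_less_Least that unfolding m_def by blast
  have "1 \<le> k \<and> k < m" if "k \<in> C" for k
    using that m assms(2) assms(3)[of k m] by (metis One_nat_def Suc_leI gr0I linorder_neqE_nat)
  then show "1 \<le> (LEAST k. 1 \<le> k \<and> k \<notin> C)" "C = {1..<LEAST k. 1 \<le> k \<and> k \<notin> C}"
    using m below unfolding m_def[symmetric] by auto
qed

text \<open>The invariant of the greedy algorithm: the predecessors of a colored vertex use exactly
  the colors below its own.\<close>

lemma greedy_from_prefix:
  assumes G: "transitive_acyclic_digraph G" and vs: "topological_ordering G vs"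
    and "vs = xs @ ys"
  shows "dom (greedy_from G Map.empty xs) = set xs \<and>
    (\<forall>v\<in>set xs. \<exists>m\<ge>1. greedy_from G Map.empty xs v = Some m \<and>
       (\<lambda>u. greedy_from G Map.empty xs u) ` {u. (u, v) \<in> parcs G} = Some ` {1..<m})"
  using assms(3)
proof (induction xs arbitrary: ys rule: rev_induct)
  case (snoc v xs)
  note D = transitive_acyclic_digraphD[OF G]
  define c where "c = greedy_from G Map.empty xs"
  have IH: "dom c = set xs"
    "\<And>v. v \<in> set xs \<Longrightarrow>
       \<exists>m\<ge>1. c v = Some m \<and> c ` {u. (u, v) \<in> parcs G} = Some ` {1..<m}"
    using snoc.IH[of "v # ys"] snoc.prems unfolding c_def by auto
  have set_vs: "set vs = pverts G" and dist: "distinct vs"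
    using vs by (auto simp: topological_ordering_def)
  have ord: "i < j" if "i < length vs" "j < length vs" "(vs ! i, vs ! j) \<in> parcs G" for i j
    using vs that unfolding topological_ordering_def by blast
  have v_nth: "vs ! length xs = v" "length xs < length vs" using snoc.prems by auto
  have pred_v: "u \<in> set xs" if "(u, v) \<in> parcs G" for u
  proof -
    have "u \<in> set vs" using that D(2) set_vs by auto
    then obtain i where i: "i < length vs" "vs ! i = u" by (auto simp: in_set_conv_nth)
    then have "i < length xs" using ord[of i "length xs"] that v_nth by simp
    then show ?thesis using i snoc.prems by (auto simp: nth_append)
  qed
  have succ_v: "u \<notin> set xs" if "(v, u) \<in> parcs G" for u
  proof
    assume "u \<in> set xs"
    then obtain i where i: "i < length xs" "xs ! i = u" by (auto simp: in_set_conv_nth)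
    then have "vs ! i = u" using snoc.prems by (auto simp: nth_append)
    then show False using ord[of "length xs" i] i(1) that v_nth by simp
  qed
  have v_notin: "v \<notin> set xs" using snoc.prems dist by auto
  \<comment> \<open>The colors forbidden for \<open>v\<close>.\<close>
  define C where "C = (\<lambda>u. the (c u)) ` {u. (u, v) \<in> parcs G}"
  have some: "c u = Some (the (c u))" if "(u, v) \<in> parcs G" for u
    using pred_v[OF that] IH(1) by (metis domD option.sel)
  have C_Some: "c ` {u. (u, v) \<in> parcs G} = Some ` C"
    unfolding C_def image_image using some by (intro image_cong) auto
  have "{u. (u, v) \<in> parcs G} \<subseteq> pverts G" using D(2) by auto
  then have fin: "finite C"
    unfolding C_def using finite_subset D(1) by (intro finite_imageI) auto
  have zero: "0 \<notin> C" using IH(2)[OF pred_v] by (force simp: C_def)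
  \<comment> \<open>By the invariant, a predecessor of color \<open>k\<close> has itself a
    predecessor of color \<open>l\<close>, which by transitivity also precedes
    \<open>v\<close>.\<close>
  have down: "l \<in> C" if k: "k \<in> C" "1 \<le> l" "l < k" for k l
  proof -
    obtain u where u: "(u, v) \<in> parcs G" "k = the (c u)" using k(1) by (auto simp: C_def)
    obtain m where m: "c u = Some m" "c ` {w. (w, u) \<in> parcs G} = Some ` {1..<m}"
      using IH(2)[OF pred_v[OF u(1)]] by auto
    have "Some l \<in> c ` {w. (w, u) \<in> parcs G}" unfolding m(2) using k u(2) m(1) by auto
    then obtain w where "(w, u) \<in> parcs G" "c w = Some l" by auto
    moreover have "(w, v) \<in> parcs G" using calculation(1) u(1) D(4) by (meson transD)
    ultimately show ?thesis unfolding C_def by force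
  qed
  define m where "m = (LEAST k. 1 \<le> k \<and> k \<notin> C)"
  \<comment> \<open>Out-neighbors of \<open>v\<close> come later in the ordering and are still
    uncolored, so only in-neighbors restrict the choice.\<close>
  have "(\<forall>u. {u, v} \<in> un_edges G \<longrightarrow> c u \<noteq> Some k) \<longleftrightarrow> k \<notin> C" for k
  proof -
    have "(\<exists>u. {u, v} \<in> un_edges G \<and> c u = Some k) \<longleftrightarrow> (\<exists>u. (u, v) \<in> parcs G \<and> c u = Some k)"
      unfolding un_edges_iff using succ_v IH(1) by (metis domI)
    also have "\<dots> \<longleftrightarrow> k \<in> C" unfolding C_def using some by force
    finally show ?thesis by blast
  qed
  then have step: "greedy_from G Map.empty (xs @ [v]) = c(v \<mapsto> m)"
    by (simp add: greedy_from_snoc c_def[symmetric] m_def)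
  have m: "1 \<le> m" "C = {1..<m}" unfolding m_def using Least_not_in_eq[OF fin zero down] by auto
  \<comment> \<open>\<open>v\<close> is a predecessor neither of itself nor of an earlier vertex, so
    coloring it leaves the invariant of these vertices untouched.\<close>
  have keep: "(c(v \<mapsto> m)) ` {u. (u, w) \<in> parcs G} = c ` {u. (u, w) \<in> parcs G}"
    if "w \<in> set xs \<or> w = v" for w
    using that succ_v D(3) by (intro image_cong) (auto simp: irrefl_def)
  show ?case
    unfolding step
  proof (intro conjI ballI)
    show "dom (c(v \<mapsto> m)) = set (xs @ [v])" using IH(1) by auto
    fix w assume w: "w \<in> set (xs @ [v])"
    then have im: "(c(v \<mapsto> m)) ` {u. (u, w) \<in> parcs G} = c ` {u. (u, w) \<in> parcs G}"
      by (intro keep) auto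
    show "\<exists>m'\<ge>1. (c(v \<mapsto> m)) w = Some m' \<and>
        (c(v \<mapsto> m)) ` {u. (u, w) \<in> parcs G} = Some ` {1..<m'}"
    proof (cases "w = v")
      case True
      then show ?thesis using im C_Some m by auto
    next
      case False
      then show ?thesis using im IH(2)[of w] w by auto
    qed
  qed
qed simp

lemma greedy_coloring_height_on:
  assumes "transitive_acyclic_digraph G" "topological_ordering G vs"
  shows "height_on (pverts G) ((parcs G)\<inverse>) (greedy_coloring G vs)"
proof -
  note D = transitive_acyclic_digraphD[OF assms(1)]
  have *: "\<exists>m\<ge>1. greedy_coloring G vs v = m \<and>
      greedy_coloring G vs ` {u. (u, v) \<in> parcs G} = {1..<m}" if "v \<in> pverts G" for v
  proof -
    have "v \<in> set vs" using assms(2) that by (simp add: topological_ordering_def)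
    then obtain m where m: "m \<ge> 1" "greedy_from G Map.empty vs v = Some m"
      "greedy_from G Map.empty vs ` {u. (u, v) \<in> parcs G} = Some ` {1..<m}"
      using greedy_from_prefix[OF assms, of vs "[]"] by auto
    have "greedy_coloring G vs ` {u. (u, v) \<in> parcs G} =
        the ` greedy_from G Map.empty vs ` {u. (u, v) \<in> parcs G}"
      by (simp add: image_image greedy_coloring_def)
    then show ?thesis using m by (simp add: image_image greedy_coloring_def)
  qed
  show ?thesis
    unfolding height_on_def
  proof (intro conjI ballI impI; clarify?)
    fix v assume v: "v \<in> pverts G"
    show "1 \<le> greedy_coloring G vs v" using *[OF v] by auto
    assume "1 < greedy_coloring G vs v"
    then have "greedy_coloring G vs v - 1 \<in> {1..<greedy_coloring G vs v}" by auto
    then have "greedy_coloring G vs v - 1 \<in> greedy_coloring G vs ` {u. (u, v) \<in> parcs G}"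
      using *[OF v] by auto
    then show "\<exists>w. (v, w) \<in> (parcs G)\<inverse> \<and>
        Suc (greedy_coloring G vs w) = greedy_coloring G vs v"
      using \<open>1 < greedy_coloring G vs v\<close> by force
  next
    fix v w assume vw: "(w, v) \<in> parcs G"
    then have "v \<in> pverts G" using D(2) by auto
    then have "greedy_coloring G vs w \<in> {1..<greedy_coloring G vs v}" using *[of v] vw by blast
    then show "greedy_coloring G vs w < greedy_coloring G vs v" by simp
  qed
qed

section \<open>Weakest preconditions with step counting\<close>

text \<open>The number of steps made so far is a ghost variable \<open>t\<close>, so that loop invariants can bound it.\<close>

definition wp ::
  "nat \<Rightarrow> ram_prog \<Rightarrow> (nat \<Rightarrow> (nat \<Rightarrow> nat) \<Rightarrow> (nat \<Rightarrow> nat) \<Rightarrow> bool) \<Rightarrow>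
   nat \<Rightarrow> (nat \<Rightarrow> nat) \<Rightarrow> (nat \<Rightarrow> nat) \<Rightarrow> bool" where
  "wp W p Q t R M \<longleftrightarrow> (\<exists>t' R' M'. ram_exec W p (R, M) t' (R', M') \<and> Q (t + t') R' M')"

lemma wp_SetConst [simp]: "wp W (SetConst i k) Q t R M \<longleftrightarrow> k \<le> W \<and> Q (Suc t) (R(i := k)) M"
  unfolding wp_def by (auto elim!: ram_exec_elims intro!: exI ram_exec.SetConst)

lemma wp_Add [simp]:
  "wp W (Add i j k) Q t R M \<longleftrightarrow> R j + R k \<le> W \<and> Q (Suc t) (R(i := R j + R k)) M"
  unfolding wp_def by (auto elim!: ram_exec_elims intro!: exI ram_exec.Add)

lemma wp_Sub [simp]: "wp W (Sub i j k) Q t R M \<longleftrightarrow> Q (Suc t) (R(i := R j - R k)) M"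
  unfolding wp_def by (auto elim!: ram_exec_elims intro!: exI ram_exec.Sub)

lemma wp_Load [simp]: "wp W (Load i j) Q t R M \<longleftrightarrow> Q (Suc t) (R(i := M (R j))) M"
  unfolding wp_def by (auto elim!: ram_exec_elims intro!: exI ram_exec.Load)

lemma wp_Store [simp]: "wp W (Store i j) Q t R M \<longleftrightarrow> Q (Suc t) R (M(R i := R j))"
  unfolding wp_def by (auto elim!: ram_exec_elims intro!: exI ram_exec.Store)

lemma wp_Seq [simp]: "wp W (Seq p q) Q t R M \<longleftrightarrow> wp W p (wp W q Q) t R M"
proof
  assume "wp W (Seq p q) Q t R M"
  then show "wp W p (wp W q Q) t R M"
    unfolding wp_def by (fastforce elim!: ram_exec_elims simp: add.assoc)
next
  assume "wp W p (wp W q Q) t R M"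
  then show "wp W (Seq p q) Q t R M"
    unfolding wp_def by (metis add.assoc ram_exec.Seq)
qed

lemma wp_mono:
  assumes "wp W p Q t R M" "\<And>t R M. Q t R M \<Longrightarrow> Q' t R M"
  shows "wp W p Q' t R M"
  using assms unfolding wp_def by blast

lemma wp_Loop_False: "R i = 0 \<Longrightarrow> Q (Suc t) R M \<Longrightarrow> wp W (Loop i p) Q t R M"
  unfolding wp_def using ram_exec.LoopFalse[of "(R, M)"] by force

lemma wp_Loop_True:
  assumes "R i \<noteq> 0" "wp W p (wp W (Loop i p) Q) (Suc t) R M"
  shows "wp W (Loop i p) Q t R M"
proof -
  obtain t1 R1 M1 t2 R2 M2 where
    "ram_exec W p (R, M) t1 (R1, M1)" "ram_exec W (Loop i p) (R1, M1) t2 (R2, M2)"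
    "Q (Suc t + t1 + t2) R2 M2"
    using assms(2) unfolding wp_def by blast
  then show ?thesis
    using ram_exec.LoopTrue[of "(R, M)" i W p t1 "(R1, M1)" t2 "(R2, M2)"] assms(1)
    unfolding wp_def by (intro exI[of _ "1 + t1 + t2"] exI[of _ R2] exI[of _ M2]) (simp add: add_ac)
qed

text \<open>The number \<open>N\<close> of iterations is known in advance and \<open>I k\<close>
  holds after \<open>k\<close> of them. This yields termination too; each \<open>Suc t\<close>
  charges for a test.\<close>

lemma wp_Loop:
  assumes init: "I 0 t R M"
    and step: "\<And>k t R M. k < N \<Longrightarrow> I k t R M \<Longrightarrow> R i \<noteq> 0 \<and> wp W p (I (Suc k)) (Suc t) R M"
    and exit: "\<And>t R M. I N t R M \<Longrightarrow> R i = 0 \<and> Q (Suc t) R M"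
  shows "wp W (Loop i p) Q t R M"
proof -
  have "wp W (Loop i p) Q t R M" if "k \<le> N" "I k t R M" for k t R M
    using that
  proof (induction k arbitrary: t R M rule: inc_induct)
    case base
    then show ?case using exit by (intro wp_Loop_False) auto
  next
    case (step k)
    then have "R i \<noteq> 0" "wp W p (I (Suc k)) (Suc t) R M" using assms(2)[of k t R M] by auto
    then show ?case using step.IH by (intro wp_Loop_True) (auto elim: wp_mono)
  qed
  then show ?thesis using init by blast
qed

section \<open>The linear-time program\<close>

text \<open>
  Vertex \<open>i\<close> is stored in a link as \<open>Suc i\<close>, and \<open>0\<close> is the null link; this suits the memory, which
  is zero outside the input.
\<close>

fun linked :: "(nat \<Rightarrow> nat) \<Rightarrow> nat \<Rightarrow> nat list \<Rightarrow> bool" where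
  "linked next p [] \<longleftrightarrow> p = 0"
| "linked next p (x # xs) \<longleftrightarrow> p = Suc x \<and> linked next (next x) xs"

lemma linked_cong: "(\<And>x. x \<in> set xs \<Longrightarrow> f x = g x) \<Longrightarrow> linked f p xs \<longleftrightarrow> linked g p xs"
  by (induction xs arbitrary: p) auto

text \<open>
  Behind the input, which ends at address \<open>R 3\<close> after the first scan, there are four arrays of
  length \<open>n\<close>: at \<open>R 3\<close> the addresses of the adjacency lists, at \<open>R 4\<close> the links of the bucket lists,
  at \<open>R 5\<close> the heads of the bucket lists (indexed by out-degree), and at \<open>R 6\<close> the heights.
  Register 1 holds the constant 1, register 2 holds \<open>n\<close>, and register 15 is never written.
  Register 0 serves as the constant 0 until \<open>visit_prog\<close> accumulates the result in it.
\<close>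

definition scan_prog :: ram_prog where
  "scan_prog = Loop 7 (Seq (Load 8 3) (Seq (Add 3 3 8) (Seq (Add 3 3 1) (Sub 7 7 1))))"

definition bucket_prog :: ram_prog where
  "bucket_prog = Loop 7
     (Seq (Load 8 9)
     (Seq (Add 11 3 10) (Seq (Store 11 9)
     (Seq (Add 12 5 8) (Seq (Load 13 12)
     (Seq (Add 11 4 10) (Seq (Store 11 13)
     (Seq (Add 10 10 1) (Seq (Store 12 10)
     (Seq (Add 9 9 8) (Seq (Add 9 9 1)
     (Sub 7 7 1))))))))))))"

text \<open>With truncated subtraction, \<open>m + (l - m)\<close> is the maximum of \<open>l\<close> and \<open>m\<close>.\<close>

definition max_prog :: ram_prog where
  "max_prog = Loop 8
     (Seq (Add 9 9 1) (Seq (Load 11 9)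
     (Seq (Add 11 11 6) (Seq (Load 11 11)
     (Seq (Sub 16 11 14) (Seq (Add 14 14 16)
     (Sub 8 8 1)))))))"

text \<open>
  Register 10 holds the current out-degree, which is also the length of the adjacency list of every
  vertex in the current bucket.
\<close>

definition visit_prog :: ram_prog where
  "visit_prog = Loop 13
     (Seq (Sub 13 13 1)
     (Seq (Add 11 3 13) (Seq (Load 9 11)
     (Seq (SetConst 14 0) (Seq (Add 8 10 15)
     (Seq max_prog
     (Seq (Add 14 14 1)
     (Seq (Add 11 6 13) (Seq (Store 11 14)
     (Seq (Sub 16 14 0) (Seq (Add 0 0 16)
     (Seq (Add 11 4 13) (Load 13 11)))))))))))))"

definition levels_prog :: ram_prog where
  "levels_prog = Loop 7
     (Seq (Add 12 5 10) (Seq (Load 13 12)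
     (Seq visit_prog
     (Seq (Add 10 10 1) (Sub 7 7 1)))))"

definition height_prog :: ram_prog where
  "height_prog =
     Seq (SetConst 1 1) (Seq (Load 2 0) (Seq (Add 7 2 0) (Seq (Add 3 1 0)
     (Seq scan_prog
     (Seq (Add 4 3 2) (Seq (Add 5 4 2) (Seq (Add 6 5 2) (Seq (Add 7 2 0) (Seq (Add 9 1 0)
     (Seq bucket_prog
     (Seq (Sub 10 10 10) (Seq (Add 7 2 0)
     levels_prog))))))))))))"

text \<open>All that the machine proof needs to know about the digraph, in terms of vertex numbers.
  \<open>pos i\<close> is the address of the block of vertex \<open>i\<close>, and
  \<open>base\<close> the first address behind the input; \<open>W\<close> leaves room for the four
  arrays.\<close>

locale ram_adj =
  fixes adj :: "nat list list" and h :: "nat \<Rightarrow> nat" and W :: nat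
    and n :: nat and deg pos :: "nat \<Rightarrow> nat" and base :: nat and input :: "nat \<Rightarrow> nat"
  defines "n \<equiv> length adj"
    and "deg \<equiv> \<lambda>i. length (adj ! i)"
    and "pos \<equiv> \<lambda>i. Suc (\<Sum>j<i. Suc (length (adj ! j)))"
    and "base \<equiv> Suc (\<Sum>j<length adj. Suc (length (adj ! j)))"
    and "input \<equiv> snd (ram_input (encode_adj adj))"
  assumes adj_less: "\<And>i j. i < n \<Longrightarrow> j \<in> set (adj ! i) \<Longrightarrow> j < n \<and> deg j < deg i"
    and deg_less: "\<And>i. i < n \<Longrightarrow> deg i < n"
    and h_eq: "\<And>i. i < n \<Longrightarrow> h i = Suc (Max (insert 0 (h ` set (adj ! i))))"
    and W: "base + 4 * n \<le> W"
begin

text \<open>The first \<open>k\<close> vertices have been inserted. Each is pushed at the front of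
  its list, hence \<open>rev\<close>.\<close>

definition bucket :: "nat \<Rightarrow> nat \<Rightarrow> nat list" where
  "bucket k d = rev (filter (\<lambda>i. deg i = d) [0..<k])"

section \<open>Layout of the encoded input\<close>

lemma pos_0: "pos 0 = 1" and pos_Suc: "pos (Suc i) = pos i + Suc (deg i)" and pos_n: "pos n = base"
  by (simp_all add: pos_def deg_def base_def n_def)

lemma pos_mono: "i \<le> j \<Longrightarrow> pos i \<le> pos j"
  by (induction rule: dec_induct) (auto simp: pos_Suc)

lemma pos_le_base: "i < n \<Longrightarrow> pos i + Suc (deg i) \<le> base"
  using pos_mono[of "Suc i" n] by (simp add: pos_Suc pos_n)

lemma n_less_base: "n < base"
proof -
  have "i < pos i" for i by (induction i) (auto simp: pos_0 pos_Suc)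
  then show ?thesis using pos_n by metis
qed

lemma encode_length: "length (concat (map (\<lambda>ns. length ns # ns) (take i adj))) + 1 = pos i"
  if "i \<le> n"
  using that
proof (induction i)
  case (Suc i)
  then show ?case by (simp add: take_Suc_conv_app_nth n_def pos_Suc deg_def)
qed (simp add: pos_0)

lemma input_0: "input 0 = n"
  by (simp add: input_def ram_input_def encode_adj_def n_def)

lemma input_outside: "base \<le> a \<Longrightarrow> input a = 0"
  using encode_length[of n] pos_n
  by (simp add: input_def ram_input_def encode_adj_def n_def pos_n[unfolded n_def])

lemma input_block:
  assumes "i < n" "k \<le> deg i"
  shows "input (pos i + k) = (length (adj ! i) # adj ! i) ! k"
proof -
  let ?f = "\<lambda>ns. length ns # (ns :: nat list)"
  define us where "us = length adj # concat (map ?f (take i adj))"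
  define ws where "ws = concat (map ?f (drop (Suc i) adj))"
  have "adj = take i adj @ adj ! i # drop (Suc i) adj"
    using assms(1) by (simp add: n_def id_take_nth_drop)
  then have "concat (map ?f adj) =
      concat (map ?f (take i adj @ adj ! i # drop (Suc i) adj))" by simp
  then have e: "encode_adj adj = us @ ?f (adj ! i) @ ws"
    by (simp add: encode_adj_def us_def ws_def)
  have l: "length us = pos i" using encode_length[of i] assms(1) by (simp add: us_def)
  have "encode_adj adj ! (pos i + k) = ?f (adj ! i) ! k"
    unfolding e using assms(2) l by (cases k) (simp_all add: nth_append deg_def)
  moreover have "pos i + k < length (encode_adj adj)"
    unfolding e using assms(2) l by (simp add: deg_def)
  ultimately show ?thesis by (simp add: input_def ram_input_def)
qed

lemma input_deg: "i < n \<Longrightarrow> input (pos i) = deg i"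
  using input_block[of i 0] by (simp add: deg_def)

lemma input_adj: "i < n \<Longrightarrow> k < deg i \<Longrightarrow> input (Suc (pos i + k)) = adj ! i ! k"
  using input_block[of i "Suc k"] by simp

text \<open>Out-neighbors have smaller out-degree, so heights are bounded inductively. As
  out-degrees are below \<open>n\<close>, every height is at most \<open>n\<close> and fits in a
  word.\<close>

lemma h_le: "i < n \<Longrightarrow> h i \<le> Suc (deg i)"
proof (induction "deg i" arbitrary: i rule: less_induct)
  case less
  have "h j \<le> deg i" if "j \<in> set (adj ! i)" for j
    using less.hyps[of j] adj_less[OF less.prems that] by linarith
  then have "Max (insert 0 (h ` set (adj ! i))) \<le> deg i" by auto
  then show ?case using h_eq[OF less.prems] by simp
qed

section \<open>Locating the blocks and sorting by out-degree\<close>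

lemma scan_prog:
  assumes "R 1 = 1" "R 3 = 1" "R 7 = n" "M = input" "R 0 = 0" "R 2 = n" "R 10 = 0" "R 15 = 0"
  shows "wp W scan_prog (\<lambda>t' R' M'. t' \<le> t + 5 * n + 1 \<and> M' = input \<and> R' 3 = base \<and>
     R' 0 = 0 \<and> R' 1 = 1 \<and> R' 2 = n \<and> R' 10 = 0 \<and> R' 15 = 0) t R M"
  unfolding scan_prog_def
proof (rule wp_Loop[where N = n and I = "\<lambda>k t' R' M'. t' \<le> t + 5 * k \<and> M' = input \<and>
     R' 3 = pos k \<and> R' 7 = n - k \<and>
     R' 0 = 0 \<and> R' 1 = 1 \<and> R' 2 = n \<and> R' 10 = 0 \<and> R' 15 = 0"], goal_cases)
  case (2 k t' R' M')
  then show ?case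
    using pos_le_base[of k] W by (simp add: input_deg pos_Suc)
qed (use assms in \<open>auto simp: pos_0 pos_n\<close>)

definition base_regs :: "(nat \<Rightarrow> nat) \<Rightarrow> bool" where
  "base_regs R \<longleftrightarrow> R 1 = 1 \<and> R 2 = n \<and> R 3 = base \<and> R 4 = base + n \<and> R 5 = base + 2 * n \<and>
     R 6 = base + 3 * n \<and> R 15 = 0"

definition buckets :: "nat \<Rightarrow> (nat \<Rightarrow> nat) \<Rightarrow> bool" where
  "buckets k M \<longleftrightarrow> (\<forall>a<base. M a = input a) \<and> (\<forall>i<k. M (base + i) = pos i) \<and>
     (\<forall>d<n. linked (\<lambda>i. M (base + n + i)) (M (base + 2 * n + d)) (bucket k d))"

lemma bucket_Suc: "bucket (Suc k) d = (if deg k = d then k # bucket k d else bucket k d)"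
  by (simp add: bucket_def)

lemma set_bucket: "set (bucket k d) = {i. i < k \<and> deg i = d}"
  by (auto simp: bucket_def)

text \<open>The only link written is that of \<open>k\<close>, which occurs in no earlier bucket, so
  the old lists stay intact.\<close>

lemma buckets_Suc:
  assumes "buckets k M" "k < n"
  shows "buckets (Suc k) (M(base + k := pos k, base + n + k := M (base + 2 * n + deg k),
           base + 2 * n + deg k := Suc k))"
    (is "buckets _ ?M")
  unfolding buckets_def
proof (intro conjI allI impI)
  fix a assume "a < base"
  then show "?M a = input a" using assms by (auto simp: buckets_def)
next
  fix i assume "i < Suc k"
  then show "?M (base + i) = pos i" using assms by (auto simp: buckets_def less_Suc_eq)
next
  fix d assume d: "d < n"
  have "linked (\<lambda>i. M (base + n + i)) (M (base + 2 * n + d)) (bucket k d)"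
    using assms d by (simp add: buckets_def)
  moreover have "linked (\<lambda>i. M (base + n + i)) p (bucket k d) \<longleftrightarrow>
      linked (\<lambda>i. ?M (base + n + i)) p (bucket k d)" for p
    using assms(2) by (intro linked_cong) (auto simp: set_bucket)
  ultimately show "linked (\<lambda>i. ?M (base + n + i)) (?M (base + 2 * n + d)) (bucket (Suc k) d)"
    using assms(2) d by (auto simp: bucket_Suc)
qed

lemma bucket_prog:
  assumes "base_regs R" "R 0 = 0" "R 7 = n" "R 9 = 1" "R 10 = 0" "M = input"
  shows "wp W bucket_prog (\<lambda>t' R' M'. t' \<le> t + 13 * n + 1 \<and> buckets n M' \<and> base_regs R' \<and> R' 0 = 0)
     t R M"
  unfolding bucket_prog_def
proof (rule wp_Loop[where N = n and I = "\<lambda>k t' R' M'. t' \<le> t + 13 * k \<and> buckets k M' \<and>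
     base_regs R' \<and> R' 0 = 0 \<and> R' 7 = n - k \<and> R' 9 = pos k \<and> R' 10 = k"], goal_cases)
  \<comment> \<open>Memory behind the input is zero and 0 is the null link, so all buckets are empty
    without initialization.\<close>
  case 1
  then show ?case
    using assms by (auto simp: buckets_def bucket_def pos_0 input_outside)
next
  case (2 k t' R' M')
  then have "M' (pos k) = deg k"
    using pos_le_base[of k] by (simp add: buckets_def input_deg)
  then show ?case
    using 2 pos_le_base[of k] deg_less[of k] W buckets_Suc[of k M']
    by (simp add: base_regs_def pos_Suc)
qed simp

section \<open>Computing the heights by increasing out-degree\<close>

definition levels :: "nat set \<Rightarrow> (nat \<Rightarrow> nat) \<Rightarrow> bool" where
  "levels P M \<longleftrightarrow> (\<forall>i\<in>P. M (base + 3 * n + i) = h i)"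

lemma max_prog:
  assumes i: "i < n" and M: "\<forall>a<base. M a = input a" "levels (set (adj ! i)) M"
    and R: "R 1 = 1" "R 6 = base + 3 * n" "R 8 = deg i" "R 9 = pos i" "R 14 = 0"
  shows "wp W max_prog (\<lambda>t' R' M'. t' \<le> t + 8 * deg i + 1 \<and> M' = M \<and>
     R' 14 = Max (insert 0 (h ` set (adj ! i))) \<and>
     (\<forall>r. r \<notin> {8, 9, 11, 14, 16} \<longrightarrow> R' r = R r)) t R M"
  unfolding max_prog_def
proof (rule wp_Loop[where N = "deg i" and I = "\<lambda>k t' R' M'. t' \<le> t + 8 * k \<and> M' = M \<and>
     R' 14 = Max (insert 0 (h ` set (take k (adj ! i)))) \<and> R' 8 = deg i - k \<and> R' 9 = pos i + k \<and>
     (\<forall>r. r \<notin> {8, 9, 11, 14, 16} \<longrightarrow> R' r = R r)"], goal_cases)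
  case (2 k t' R' M')
  define j where "j = adj ! i ! k"
  define m where "m = Max (insert 0 (h ` set (take k (adj ! i))))"
  have j: "j \<in> set (adj ! i)" using 2(1) by (simp add: j_def deg_def)
  have "pos i + Suc k < base" using pos_le_base[OF i] 2(1) by linarith
  then have Mj: "M (Suc (pos i + k)) = j" using M(1) 2(1) i by (simp add: input_adj j_def)
  have Mh: "M (j + (base + 3 * n)) = h j" using M(2) j by (simp add: levels_def add.commute)
  have "set (take (Suc k) (adj ! i)) = insert j (set (take k (adj ! i)))"
    using 2(1) by (simp add: take_Suc_conv_app_nth deg_def j_def)
  then have m': "Max (insert 0 (h ` set (take (Suc k) (adj ! i)))) = max (h j) m"
    unfolding m_def
    by (simp add: insert_commute[of 0] Max_insert[of "insert 0 (h ` set (take k (adj ! i)))" "h j"])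
  have jn: "j < n" "deg j < deg i" using adj_less[OF i j] by auto
  have bnd: "h x \<le> n" if "x \<in> set (adj ! i)" for x
    using h_le[of x] adj_less[OF i that] deg_less[OF i] by linarith
  have "m \<le> n" unfolding m_def using bnd by (auto dest: in_set_takeD)
  then have "m + (h j - m) \<le> W" using bnd[OF j] W by linarith
  moreover have "m + (h j - m) = max (h j) m" by simp
  ultimately show ?case
    using 2 R Mj Mh m' jn W \<open>pos i + Suc k < base\<close> unfolding m_def[symmetric] by simp
qed (use R in \<open>auto simp: deg_def\<close>)

text \<open>The steps for one vertex in \<open>visit_prog\<close>: one test, 12 instructions outside
  \<open>max_prog\<close>, and \<open>8 * deg i + 1\<close> steps inside it.\<close>

definition cost :: "nat \<Rightarrow> nat" where
  "cost i = 14 + 8 * deg i"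

text \<open>Out-degrees drop strictly along arcs, so all out-neighbors of a vertex in bucket
  \<open>d\<close> were handled in earlier buckets, and the order within the bucket is
  irrelevant.\<close>

lemma visit_prog:
  assumes d: "d < n"
    and M: "buckets n M" "levels {i. i < n \<and> deg i < d} M"
    and R: "base_regs R" "R 13 = M (base + 2 * n + d)" "R 10 = d"
      "R 0 = Max (insert 0 (h ` {i. i < n \<and> deg i < d}))"
  shows "wp W visit_prog (\<lambda>t' R' M'. t' \<le> t + sum_list (map cost (bucket n d)) + 1 \<and>
     buckets n M' \<and> levels {i. i < n \<and> deg i < Suc d} M' \<and> base_regs R' \<and> R' 10 = d \<and> R' 7 = R 7 \<and>
     R' 0 = Max (insert 0 (h ` {i. i < n \<and> deg i < Suc d}))) t R M"
proof -
  define B where "B = bucket n d"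
  \<comment> \<open>The vertices whose heights are stored after \<open>k\<close> visits in this
    bucket.\<close>
  define P where "P k = {i. i < n \<and> deg i < d} \<union> set (take k B)" for k
  have P_fin: "finite (P k)" for k unfolding P_def by simp
  have P_less: "i < n" if "i \<in> P k" for i k
    using that by (auto simp: P_def B_def set_bucket dest!: in_set_takeD)
  have P_end: "P (length B) = {i. i < n \<and> deg i < Suc d}"
    by (auto simp: P_def B_def set_bucket)
  show ?thesis
    unfolding visit_prog_def
  proof (rule wp_Loop[where N = "length B" and I = "\<lambda>k t' R' M'.
       t' \<le> t + sum_list (map cost (take k B)) \<and> buckets n M' \<and> levels (P k) M' \<and>
       base_regs R' \<and> R' 10 = d \<and> R' 7 = R 7 \<and> R' 0 = Max (insert 0 (h ` P k)) \<and>
       linked (\<lambda>i. M' (base + n + i)) (R' 13) (drop k B)"], goal_cases)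
    case 1
    then show ?case using assms by (simp add: P_def buckets_def B_def)
  next
    case (2 k t' R' M')
    define i where "i = B ! k"
    define m where "m = Max (insert 0 (h ` P k))"
    have drop: "drop k B = i # drop (Suc k) B" using 2(1) by (simp add: i_def Cons_nth_drop_Suc)
    have "i \<in> set B" using 2(1) by (simp add: i_def)
    then have i: "i < n" "deg i = d" by (auto simp: B_def set_bucket)
    have P_Suc: "P (Suc k) = insert i (P k)"
      using 2(1) by (auto simp: P_def take_Suc_conv_app_nth i_def)
    have hi: "h i = Suc (Max (insert 0 (h ` set (adj ! i))))" using h_eq i by simp
    have hn: "h j \<le> n" if "j < n" for j using h_le[OF that] deg_less[OF that] by linarith
    have "m \<le> n" unfolding m_def using hn P_less P_fin by auto
    have mh: "m + (h i - m) = Max (insert 0 (h ` P (Suc k)))"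
      unfolding P_Suc m_def using P_fin[of k]
      by (simp add: insert_commute[of 0] Max_insert[of "insert 0 (h ` P k)" "h i"])
    have lev: "levels (set (adj ! i)) M'"
      using 2(2) adj_less[OF i(1)] i(2) by (auto simp: levels_def P_def)
    have next_i: "R' 13 = Suc i" "linked (\<lambda>i. M' (base + n + i)) (M' (base + n + i)) (drop (Suc k) B)"
      using 2(2) drop by auto
    have ptr: "M' (base + i) = pos i" using 2(2) i by (simp add: buckets_def)
    \<comment> \<open>The only write of the iteration. It lies behind the input and the bucket
      arrays, so these survive.\<close>
    define M'' where "M'' = M'(base + 3 * n + i := h i)"
    have M''_below: "M'' a = M' a" if "a < base + 3 * n" for a using that by (simp add: M''_def)
    have bM'': "buckets n M''"
    proof -
      have "linked (\<lambda>i. M'' (base + n + i)) p (bucket n d) \<longleftrightarrow>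
          linked (\<lambda>i. M' (base + n + i)) p (bucket n d)" for p d
        by (intro linked_cong) (auto simp: set_bucket M''_below)
      then show ?thesis using 2(2) by (auto simp: buckets_def M''_below)
    qed
    have lM'': "levels (P (Suc k)) M''"
      using 2(2) by (auto simp: levels_def P_Suc M''_def)
    have nM'': "linked (\<lambda>i. M'' (base + n + i)) (M'' (base + n + i)) (drop (Suc k) B)"
    proof -
      have "M'' (base + n + i) = M' (base + n + i)" using i by (simp add: M''_below)
      moreover have "linked (\<lambda>i. M'' (base + n + i)) p (drop (Suc k) B) \<longleftrightarrow>
          linked (\<lambda>i. M' (base + n + i)) p (drop (Suc k) B)" for p
        by (intro linked_cong) (auto simp: B_def set_bucket M''_below dest!: in_set_dropD)
      ultimately show ?thesis using next_i(2) by simp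
    qed
    have cost: "sum_list (map cost (take (Suc k) B)) =
        sum_list (map cost (take k B)) + 14 + 8 * d"
      using 2(1) i by (simp add: take_Suc_conv_app_nth i_def cost_def)
    \<comment> \<open>Six steps have passed in this iteration: the loop test and the five
      instructions before \<open>max_prog\<close>.\<close>
    have final: "wp W max_prog (wp W
         (Seq (Add 14 14 1)
         (Seq (Add 11 6 13) (Seq (Store 11 14)
         (Seq (Sub 16 14 0) (Seq (Add 0 0 16)
         (Seq (Add 11 4 13) (Load 13 11))))))) (\<lambda>t' R' M'.
       t' \<le> t + sum_list (map cost (take (Suc k) B)) \<and> buckets n M' \<and> levels (P (Suc k)) M' \<and>
       base_regs R' \<and> R' 10 = d \<and> R' 7 = R 7 \<and> R' 0 = Max (insert 0 (h ` P (Suc k))) \<and>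
       linked (\<lambda>i. M' (base + n + i)) (R' 13) (drop (Suc k) B)))
        (Suc (Suc (Suc (Suc (Suc (Suc t'))))))
        (R'(13 := i, 11 := base + i, 9 := pos i, 14 := 0, 8 := d)) M'"
    proof (intro wp_mono[OF max_prog[OF i(1) _ lev]], goal_cases)
      case (7 t3 R3 M3)
      then have R3: "M3 = M'" "Suc (R3 14) = h i" "t3 \<le> t' + 7 + 8 * d" "base_regs R3"
        "R3 10 = d" "R3 7 = R 7" "R3 0 = m" "R3 13 = i"
        using 2(2) i hi by (auto simp: base_regs_def m_def)
      show ?case
        using R3 2(2) bM'' lM'' nM'' cost mh hn[OF i(1)] \<open>m \<le> n\<close> W i n_less_base
        by (simp add: base_regs_def M''_def)
    qed (use 2(2) i in \<open>auto simp: buckets_def base_regs_def\<close>)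
    show ?case
      using final 2(2) next_i(1) ptr W i n_less_base deg_less[OF i(1)]
      by (simp add: base_regs_def)
  next
    case (3 t' R' M')
    then show ?case by (simp add: P_end B_def[symmetric])
  qed
qed

lemma levels_prog:
  assumes M: "buckets n M" and R: "base_regs R" "R 0 = 0" "R 7 = n" "R 10 = 0"
  shows "wp W levels_prog (\<lambda>t' R' M'. t' \<le> t + 20 * n + 8 * (\<Sum>i<n. deg i) + 1 \<and>
     R' 0 = Max (insert 0 (h ` {..<n}))) t R M"
proof -
  \<comment> \<open>The buckets partition the vertices, so the costs sum up over vertices. The 6
    added per bucket below counts two tests and four instructions.\<close>
  have "(\<Sum>d<n. sum_list (map cost (bucket n d))) = (\<Sum>d<n. \<Sum>i | i \<in> {..<n} \<and> deg i = d. cost i)"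
    by (intro sum.cong refl, subst sum_list_distinct_conv_sum_set)
       (auto simp: bucket_def intro!: sum.cong)
  also have "\<dots> = (\<Sum>i<n. cost i)"
    using deg_less by (intro sum.group) auto
  also have "\<dots> = 14 * n + 8 * (\<Sum>i<n. deg i)"
    by (simp add: cost_def sum.distrib sum_distrib_left)
  finally have total: "(\<Sum>d<n. 6 + sum_list (map cost (bucket n d))) = 20 * n + 8 * (\<Sum>i<n. deg i)"
    by (simp add: sum.distrib)
  have all: "{i. i < n \<and> deg i < n} = {..<n}" using deg_less by auto
  show ?thesis
    unfolding levels_prog_def
  proof (rule wp_Loop[where N = n and I = "\<lambda>d t' R' M'.
       t' \<le> t + (\<Sum>e<d. 6 + sum_list (map cost (bucket n e))) \<and> buckets n M' \<and>
       levels {i. i < n \<and> deg i < d} M' \<and> base_regs R' \<and> R' 10 = d \<and> R' 7 = n - d \<and>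
       R' 0 = Max (insert 0 (h ` {i. i < n \<and> deg i < d}))"], goal_cases)
    case 1
    then show ?case using assms by (simp add: levels_def)
  next
    case (2 d t' R' M')
    have "wp W visit_prog (wp W (Seq (Add 10 10 1) (Sub 7 7 1)) (\<lambda>t' R' M'.
         t' \<le> t + (\<Sum>e<Suc d. 6 + sum_list (map cost (bucket n e))) \<and> buckets n M' \<and>
         levels {i. i < n \<and> deg i < Suc d} M' \<and> base_regs R' \<and> R' 10 = Suc d \<and> R' 7 = n - Suc d \<and>
         R' 0 = Max (insert 0 (h ` {i. i < n \<and> deg i < Suc d}))))
       (t' + 3) (R'(12 := base + 2 * n + d, 13 := M' (base + 2 * n + d))) M'"
    proof (intro wp_mono[OF visit_prog[OF 2(1)]], goal_cases)
      case (7 t3 R3 M3)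
      then show ?case using 2 W n_less_base by (simp add: base_regs_def)
    qed (use 2(2) in \<open>auto simp: base_regs_def\<close>)
    then show ?case using 2 W by (simp add: base_regs_def numeral_3_eq_3)
  next
    case (3 t' R' M')
    then show ?case using total all by simp
  qed
qed

text \<open>The phases are treated from last to first, each with the step bound reached so far:
  \<open>5 * n + 5\<close> after scanning and \<open>18 * n + 11\<close> after bucketing.\<close>

lemma height_prog:
  "wp W height_prog (\<lambda>t R M. t \<le> 38 * n + 8 * (\<Sum>i<n. deg i) + 14 \<and> R 0 = Max (insert 0 (h ` {..<n})))
     0 (\<lambda>_. 0) input"
proof -
  have levels: "wp W (Seq (Sub 10 10 10) (Seq (Add 7 2 0) levels_prog))
      (\<lambda>t R M. t \<le> 38 * n + 8 * (\<Sum>i<n. deg i) + 14 \<and> R 0 = Max (insert 0 (h ` {..<n}))) t R M"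
    if "t \<le> 18 * n + 11" "buckets n M" "base_regs R" "R 0 = 0" for t R M
  proof -
    have "wp W levels_prog (\<lambda>t' R' M'. t' \<le> (t + 2) + 20 * n + 8 * (\<Sum>i<n. deg i) + 1 \<and>
        R' 0 = Max (insert 0 (h ` {..<n}))) (t + 2) (R(10 := 0, 7 := n)) M"
      using that by (intro levels_prog) (auto simp: base_regs_def)
    then show ?thesis
      using that W by (auto simp: base_regs_def elim!: wp_mono)
  qed
  have buckets: "wp W (Seq (Add 4 3 2) (Seq (Add 5 4 2) (Seq (Add 6 5 2) (Seq (Add 7 2 0)
        (Seq (Add 9 1 0) (Seq bucket_prog (Seq (Sub 10 10 10) (Seq (Add 7 2 0) levels_prog))))))))
      (\<lambda>t R M. t \<le> 38 * n + 8 * (\<Sum>i<n. deg i) + 14 \<and> R 0 = Max (insert 0 (h ` {..<n}))) t R M"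
    if "t \<le> 5 * n + 5" "M = input" "R 3 = base" "R 0 = 0" "R 1 = 1" "R 2 = n" "R 10 = 0" "R 15 = 0"
    for t R M
  proof -
    have "wp W bucket_prog (wp W (Seq (Sub 10 10 10) (Seq (Add 7 2 0) levels_prog))
        (\<lambda>t R M. t \<le> 38 * n + 8 * (\<Sum>i<n. deg i) + 14 \<and> R 0 = Max (insert 0 (h ` {..<n}))))
        (Suc (Suc (Suc (Suc (Suc t)))))
        (R(4 := base + n, 5 := base + n + n, 6 := base + n + n + n, 7 := n, 9 := 1)) M"
      by (rule wp_mono[OF bucket_prog levels]) (use that in \<open>auto simp: base_regs_def\<close>)
    then show ?thesis
      using that W n_less_base by simp
  qed
  have "wp W scan_prog (wp W (Seq (Add 4 3 2) (Seq (Add 5 4 2) (Seq (Add 6 5 2) (Seq (Add 7 2 0)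
        (Seq (Add 9 1 0) (Seq bucket_prog (Seq (Sub 10 10 10) (Seq (Add 7 2 0) levels_prog))))))))
      (\<lambda>t R M. t \<le> 38 * n + 8 * (\<Sum>i<n. deg i) + 14 \<and> R 0 = Max (insert 0 (h ` {..<n}))))
      (Suc (Suc (Suc (Suc 0)))) ((\<lambda>_. 0)(1 := 1, 2 := n, 7 := n, 3 := 1)) input"
    by (rule wp_mono[OF scan_prog buckets]) auto
  then show ?thesis
    unfolding height_prog_def using W n_less_base by (simp add: input_0)
qed

end

section \<open>From adjacency lists back to digraphs\<close>

lemma adjacency_lists_card_parcs:
  assumes "adjacency_lists G xs adj" "parcs G \<subseteq> pverts G \<times> pverts G"
  shows "card (parcs G) = (\<Sum>i<length adj. length (adj ! i))"
proof -
  note A = assms(1)[unfolded adjacency_lists_def]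
  have "bij_betw (\<lambda>(i, j). (xs ! i, xs ! j)) (SIGMA i:{..<length adj}. set (adj ! i)) (parcs G)"
    unfolding bij_betw_def
  proof
    show "inj_on (\<lambda>(i, j). (xs ! i, xs ! j)) (SIGMA i:{..<length adj}. set (adj ! i))"
      using A by (auto simp: inj_on_def nth_eq_iff_index_eq)
    show "(\<lambda>(i, j). (xs ! i, xs ! j)) ` (SIGMA i:{..<length adj}. set (adj ! i)) = parcs G"
    proof (intro equalityI subsetI)
      fix e assume e: "e \<in> parcs G"
      then have "fst e \<in> set xs" "snd e \<in> set xs" using assms(2) A by auto
      then obtain i j where "i < length xs" "xs ! i = fst e" "j < length xs" "xs ! j = snd e"
        by (metis in_set_conv_nth)
      then show "e \<in> (\<lambda>(i, j). (xs ! i, xs ! j)) ` (SIGMA i:{..<length adj}. set (adj ! i))"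
        using A e by (intro image_eqI[of _ _ "(i, j)"]) auto
    qed (use A in auto)
  qed
  then have "card (parcs G) = card (SIGMA i:{..<length adj}. set (adj ! i))"
    by (simp add: bij_betw_same_card)
  also have "\<dots> = (\<Sum>i<length adj. length (adj ! i))"
  proof (subst card_SigmaI)
    show "(\<Sum>i<length adj. card (set (adj ! i))) = (\<Sum>i<length adj. length (adj ! i))"
      using A by (intro sum.cong refl) (metis distinct_card lessThan_iff)
  qed auto
  finally show ?thesis .
qed

text \<open>The factor 40 covers both the step count and the largest address, which is below five
  times the number of vertices plus the number of arcs plus 1.\<close>

lemma height_prog_computes_oriented_chromatic_number:
  assumes G: "transitive_acyclic_digraph G" and A: "adjacency_lists G xs adj"
  defines "B \<equiv> 40 * (card (pverts G) + card (parcs G) + 1)"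
  shows "\<exists>t R M. ram_exec B height_prog (ram_input (encode_adj adj)) t (R, M) \<and>
     t \<le> B \<and> R 0 = oriented_chromatic_number G"
proof -
  note D = transitive_acyclic_digraphD[OF G]
  obtain c where c: "height_on (pverts G) (parcs G) c"
    using ex_height_on[OF D(1,2,4,3)] by blast
  have dist: "distinct xs" and set_xs: "set xs = pverts G" and len: "length adj = length xs"
    and dist_adj: "\<And>i. i < length xs \<Longrightarrow> distinct (adj ! i)"
    and set_adj: "\<And>i. i < length xs \<Longrightarrow>
      set (adj ! i) = {j. j < length xs \<and> (xs ! i, xs ! j) \<in> parcs G}"
    using A by (auto simp: adjacency_lists_def)
  have card_adj: "length (adj ! i) = card (set (adj ! i))" if "i < length xs" for i
    using dist_adj[OF that] by (simp add: distinct_card)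
  have n: "card (pverts G) = length adj"
    using distinct_card[OF dist] set_xs len by simp
  have m: "card (parcs G) = (\<Sum>i<length adj. length (adj ! i))"
    by (rule adjacency_lists_card_parcs[OF A D(2)])
  have B: "B = 40 * length adj + 40 * (\<Sum>i<length adj. length (adj ! i)) + 40"
    by (simp add: B_def n m)
  have irr: "i \<notin> set (adj ! i)" if "i < length xs" for i
    using set_adj[OF that] D(3) by (auto simp: irrefl_def)
  interpret ram_adj adj "\<lambda>i. c (xs ! i)" B "length adj" "\<lambda>i. length (adj ! i)"
    "\<lambda>i. Suc (\<Sum>j<i. Suc (length (adj ! j)))" "Suc (\<Sum>j<length adj. Suc (length (adj ! j)))"
    "snd (ram_input (encode_adj adj))"
  proof (unfold_locales, goal_cases)
    case (1 i j)
    then have ij: "i < length xs" "j < length xs" "(xs ! i, xs ! j) \<in> parcs G"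
      using set_adj[of i] len by auto
    \<comment> \<open>By transitivity. The inclusion is strict since \<open>j\<close> is an
      out-neighbor of \<open>i\<close> but not of itself.\<close>
    have "set (adj ! j) \<subseteq> set (adj ! i)"
      using set_adj ij D(4) by (auto dest: transD)
    then have "set (adj ! j) \<subset> set (adj ! i)" using 1(2) irr[OF ij(2)] by auto
    then have "card (set (adj ! j)) < card (set (adj ! i))" by (intro psubset_card_mono) auto
    then show ?case using card_adj ij len by simp
  next
    case (2 i)
    then have "set (adj ! i) \<subset> {..<length xs}" using set_adj[of i] irr[of i] len by auto
    then have "card (set (adj ! i)) < card {..<length xs}" by (intro psubset_card_mono) auto
    then show ?case using card_adj[of i] 2 len by simp
  next
    case (3 i)
    then have i: "i < length xs" "xs ! i \<in> pverts G"
      using len set_xs[symmetric] by simp_all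
    have "parcs G `` {xs ! i} \<subseteq> (\<lambda>j. xs ! j) ` set (adj ! i)"
    proof
      fix w assume w: "w \<in> parcs G `` {xs ! i}"
      then have "w \<in> set xs" using D(2) set_xs by auto
      then show "w \<in> (\<lambda>j. xs ! j) ` set (adj ! i)"
        unfolding set_adj[OF i(1)] using w by (auto simp: in_set_conv_nth)
    qed
    moreover have "(\<lambda>j. xs ! j) ` set (adj ! i) \<subseteq> parcs G `` {xs ! i}"
      using set_adj[OF i(1)] by auto
    ultimately have succ: "parcs G `` {xs ! i} = (\<lambda>j. xs ! j) ` set (adj ! i)" by blast
    have "c (xs ! i) = Suc (Max (insert 0 (c ` (parcs G `` {xs ! i}))))"
      by (rule height_on_eq_Suc_Max[OF c i(2)]) (simp add: succ)
    then show ?case by (simp only: succ image_image)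
  next
    case 4
    have "(\<Sum>j<length adj. Suc (length (adj ! j))) =
        length adj + (\<Sum>j<length adj. length (adj ! j))"
      by (simp add: sum_Suc)
    then show ?case unfolding B by linarith
  qed
  have "(\<lambda>i. c (xs ! i)) ` {..<length adj} = c ` pverts G"
    unfolding len set_xs[symmetric] by (auto simp: set_conv_nth)
  then have chi: "oriented_chromatic_number G =
      Max (insert 0 ((\<lambda>i. c (xs ! i)) ` {..<length adj}))"
    using height_on_optimal_oriented_coloring(3)[OF G _ c] by simp
  have input: "ram_input (encode_adj adj) = (\<lambda>_. 0, snd (ram_input (encode_adj adj)))"
    by (simp add: ram_input_def)
  obtain t R M where run: "ram_exec B height_prog (ram_input (encode_adj adj)) t (R, M)"
    "t \<le> 38 * length adj + 8 * (\<Sum>i<length adj. length (adj ! i)) + 14"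
    "R 0 = oriented_chromatic_number G"
    using height_prog unfolding wp_def chi input[symmetric] by auto
  moreover have "t \<le> B" using run(2) B by linarith
  ultimately show ?thesis by blast
qed

theorem theorem3p1:
  shows "(\<forall>G :: 'a pair_pre_digraph. transitive_acyclic_digraph G \<longrightarrow>
            (\<forall>vs. topological_ordering G vs \<longrightarrow>
               oriented_coloring G (oriented_chromatic_number G) (greedy_coloring G vs) \<and>
               card (greedy_coloring G vs ` pverts G) = oriented_chromatic_number G)) \<and>
         linear_time_computable
           (transitive_acyclic_digraph :: 'a pair_pre_digraph \<Rightarrow> bool)
           oriented_chromatic_number"
proof (intro conjI allI impI)
  fix G :: "'a pair_pre_digraph" and vs
  assume "transitive_acyclic_digraph G" "topological_ordering G vs"
  \<comment> \<open>\<open>disjI2\<close> selects the converse of the arcs, since greedy colors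
    measure chains ending at a vertex.\<close>
  note height_on_optimal_oriented_coloring
    [OF this(1) disjI2[OF refl] greedy_coloring_height_on[OF this]]
  then show "oriented_coloring G (oriented_chromatic_number G) (greedy_coloring G vs)"
    and "card (greedy_coloring G vs ` pverts G) = oriented_chromatic_number G" by auto
next
  show "linear_time_computable (transitive_acyclic_digraph :: 'a pair_pre_digraph \<Rightarrow> bool)
      oriented_chromatic_number"
    unfolding linear_time_computable_def
    using height_prog_computes_oriented_chromatic_number
    by (intro exI[of _ height_prog] exI[of _ 40]) blast
qed

end
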